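(* Let $n\ge2$ and let $k$ be an even non-negative integer. Let $P$ be the unique (up to a constant) non-zero bi-invariant polynomial in $\mathrm H^k$, let $f_P=P|_{S^{4n-1}}$ be the corresponding bi-invariant spherical harmonic, and let $F:[0,\frac\pi2]\to\mathbb C$ be defined by $F(\theta)=f_P(x(\theta))$, where $x(\theta)=(\cos\theta,0,\dots,0,\sin\theta)\in\mathbb H^n$. Then: (a) The restriction of $F$ to the open interval $\left]0,\frac\pi2\right[$ satisfies $$F''(\theta)+\left(\frac{6}{\tan(2\theta)}+\frac{4n-8}{\tan\theta}\right)F'(\theta)+k(k+4n-2)\,F(\theta)=0$$ (where $\frac{1}{\tan(2\theta)}$ is understood as $\cot(2\theta)$). (b) Let $\psi:\left]0,\frac\pi2\right[\to\,]0,1[$ be the smooth diffeomorphism $\psi(\theta)=\cos^2\theta$. Then $\varphi=F\circ\psi^{-1}$ satisfies the hypergeometric differential equation $$\tau(1-\tau)\,\varphi''(\tau)+2(1-n\tau)\,\varphi'(\tau)+\frac k2\left(\frac k2+2n-1\right)\varphi(\tau)=0\qquad(\tau\in\,]0,1[).$$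
   Context: $\mathbb H$ denotes the quaternions, written $q=a+jb$ with $a,b\in\mathbb C$, $j^2=-1$, $jz=\bar zj$ for $z\in\mathbb C$. $\mathbb H^n$ is a right $\mathbb H$-vector space; $h\in\mathbb H^n$ is written $h=z+jw$ with $(z,w)\in\mathbb C^n\times\mathbb C^n$, which identifies $\mathbb H^n\simeq\mathbb C^{2n}\simeq\mathbb R^{4n}$, and $S^{4n-1}$ is the unit sphere. $\mathrm{Sp}(n)$ is the group of linear isometries of $\mathbb H^n$ ($n\times n$ quaternionic matrices acting on the left of column vectors). $\mathrm H^k$ is the complex vector space of complex-valued harmonic polynomials on $\mathbb R^{4n}$, homogeneous of degree $k$. The left action of $\mathrm{Sp}(n)$ on functions is $L(g)f(h)=f(g^{-1}h)$. The right action of $\mathrm{Sp}(1)$ (unit quaternions $q=a+jb$) on functions is $R(q)f(h)=f(hq)$, i.e. $R(q)f(z,w)=f(az-b\bar w,\,aw+b\bar z)$. $1\times\mathrm{Sp}(n-1)$ is the subgroup of $\mathrm{Sp}(n)$ of matrices $\begin{pmatrix}1&0\\0&A\end{pmatrix}$ with $A\in\mathrm{Sp}(n-1)$. A polynomial in $\mathrm H^k$, or its restriction to $S^{4n-1}$, is called bi-invariant if it is invariant under the left action of $1\times\mathrm{Sp}(n-1)$ and under the right action of $\mathrm{Sp}(1)$. For $k$ even, $\mathrm H^k$ contains a non-zero bi-invariant polynomial, unique up to a multiplicative constant. *)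

theory Defs
  imports "HOL-Analysis.Analysis"
begin

section \<open>Quaternions\<close>

text \<open>\<open>Quat a b\<close> is the quaternion \<open>a + j b\<close>, with \<open>j\<^sup>2 = -1\<close> and \<open>j z = cnj z j\<close> for complex \<open>z\<close>.\<close>

datatype quat = Quat (zpart: complex) (wpart: complex)

lemma quat_eq_iff: "p = q \<longleftrightarrow> zpart p = zpart q \<and> wpart p = wpart q"
  by (cases p; cases q) simp

instantiation quat :: ring_1
begin

definition "0 = Quat 0 0"
definition "1 = Quat 1 0"
definition "p + q = Quat (zpart p + zpart q) (wpart p + wpart q)"
definition "- p = Quat (- zpart p) (- wpart p)"
definition "p - q = Quat (zpart p - zpart q) (wpart p - wpart q)"

text \<open>\<open>(a + j b) (c + j d) = (a c - cnj b d) + j (b c + cnj a d)\<close>\<close>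

definition "p * q =
  Quat (zpart p * zpart q - cnj (wpart p) * wpart q)
       (wpart p * zpart q + cnj (zpart p) * wpart q)"

instance
  by standard
    (simp_all add: zero_quat_def one_quat_def plus_quat_def uminus_quat_def minus_quat_def
       times_quat_def quat_eq_iff algebra_simps)

end

lemma quat_sel [simp]:
  "zpart 0 = 0" "wpart 0 = 0" "zpart 1 = 1" "wpart 1 = 0"
  "zpart (p + q) = zpart p + zpart q" "wpart (p + q) = wpart p + wpart q"
  "zpart (- p) = - zpart p" "wpart (- p) = - wpart p"
  "zpart (p - q) = zpart p - zpart q" "wpart (p - q) = wpart p - wpart q"
  "zpart (p * q) = zpart p * zpart q - cnj (wpart p) * wpart q"
  "wpart (p * q) = wpart p * zpart q + cnj (zpart p) * wpart q"
  by (simp_all add: zero_quat_def one_quat_def plus_quat_def uminus_quat_def minus_quat_def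
      times_quat_def)

lemma quat_j_rules:
  "Quat 0 1 * Quat 0 1 = - 1"
  "Quat 0 1 * Quat z 0 = Quat (cnj z) 0 * Quat 0 1"
  "Quat a b = Quat a 0 + Quat 0 1 * Quat b 0"
  by (simp_all add: quat_eq_iff)

instantiation quat :: real_vector
begin

definition "r *\<^sub>R q = Quat (r *\<^sub>R zpart q) (r *\<^sub>R wpart q)"

instance
  by standard (simp_all add: scaleR_quat_def quat_eq_iff algebra_simps)

end

instantiation quat :: real_inner
begin

definition "inner p q = inner (zpart p) (zpart q) + inner (wpart p) (wpart q)"
definition norm_quat_def: "norm (q :: quat) = sqrt (inner q q)"
definition sgn_quat_def: "sgn (q :: quat) = q /\<^sub>R norm q"
definition dist_quat_def: "dist (p :: quat) q = norm (p - q)"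
definition uniformity_quat_def [code del]:
  "(uniformity :: (quat \<times> quat) filter) = (INF e\<in>{0 <..}. principal {(p, q). dist p q < e})"
definition open_quat_def [code del]:
  "open (U :: quat set) \<longleftrightarrow> (\<forall>p\<in>U. eventually (\<lambda>(p', q). p' = p \<longrightarrow> q \<in> U) uniformity)"

instance
proof
  fix p q r :: quat and s :: real
  show "inner p q = inner q p" "inner (p + q) r = inner p r + inner q r"
    "inner (s *\<^sub>R p) q = s * inner p q" "0 \<le> inner p p"
    by (simp_all add: inner_quat_def scaleR_quat_def inner_commute algebra_simps)
  show "inner p p = 0 \<longleftrightarrow> p = 0"
    by (simp add: inner_quat_def quat_eq_iff add_nonneg_eq_0_iff)
qed (simp_all add: norm_quat_def sgn_quat_def dist_quat_def uniformity_quat_def open_quat_def)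

end

lemma scaleR_quat_sel [simp]:
  "zpart (r *\<^sub>R q) = r *\<^sub>R zpart q" "wpart (r *\<^sub>R q) = r *\<^sub>R wpart q"
  by (simp_all add: scaleR_quat_def)

lemma norm_quat: "norm (Quat a b) = sqrt ((cmod a)\<^sup>2 + (cmod b)\<^sup>2)"
  by (simp add: norm_quat_def inner_quat_def power2_norm_eq_inner)

instantiation quat :: euclidean_space
begin

definition "(Basis :: quat set) = {Quat 1 0, Quat \<i> 0, Quat 0 1, Quat 0 \<i>}"

instance
proof
  fix p q :: quat
  show "(Basis :: quat set) \<noteq> {}" "finite (Basis :: quat set)"
    by (simp_all add: Basis_quat_def)
  show "inner p q = (if p = q then 1 else 0)" if "p \<in> Basis" "q \<in> Basis"
    using that unfolding Basis_quat_def
    by (elim insertE emptyE; simp add: inner_quat_def inner_complex_def)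
  show "(\<forall>u\<in>Basis. inner p u = 0) \<longleftrightarrow> p = 0"
    by (auto simp: Basis_quat_def inner_quat_def inner_complex_def quat_eq_iff[of p] complex_eq_iff)
qed

end


section \<open>Harmonic polynomials\<close>

definition laplacian :: "('a :: euclidean_space \<Rightarrow> complex) \<Rightarrow> 'a \<Rightarrow> complex" where
  "laplacian f x =
     (\<Sum>b\<in>Basis. frechet_derivative (\<lambda>y. frechet_derivative f (at y) b) (at x) b)"

definition harmonic_polys :: "nat \<Rightarrow> ('a :: euclidean_space \<Rightarrow> complex) set" where
  "harmonic_polys k =
     {P. polynomial_function P \<and>
         (\<forall>(t::real) x. P (t *\<^sub>R x) = of_real t ^ k * P x) \<and>
         (\<forall>x. laplacian P x = 0)}"


section \<open>The group actions on functions on \<open>\<bbbH>\<^sup>n\<close>\<close>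

text \<open>
  \<open>\<bbbH>\<^sup>n\<close> is \<^typ>\<open>quat ^ 'n\<close> with \<open>n = CARD('n)\<close>; the order on the index type serves to
  single out the first coordinate \<open>Min UNIV\<close> and the last one \<open>Max UNIV\<close>.
\<close>

definition Sp :: "(quat ^ 'n ^ 'n) set" where
  "Sp = {g. \<forall>h. norm (g *v h) = norm h}"

text \<open>
  The matrices \<open>(1 0; 0 A)\<close> with \<open>A \<in> Sp(n-1)\<close>: for a matrix of this shape, being in \<open>Sp(n)\<close>
  means precisely that \<open>A\<close> is in \<open>Sp(n-1)\<close>, see \<open>one_times_Sp_iff\<close>.
\<close>

definition one_times_Sp :: "(quat ^ ('n :: {finite, linorder}) ^ ('n :: {finite, linorder})) set" where
  "one_times_Sp = {g \<in> Sp. g $ Min UNIV $ Min UNIV = 1 \<and>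
     (\<forall>i. i \<noteq> Min UNIV \<longrightarrow> g $ Min UNIV $ i = 0 \<and> g $ i $ Min UNIV = 0)}"

definition Sp1 :: "quat set" where
  "Sp1 = {q. norm q = 1}"

definition left_act ::
    "quat ^ 'n ^ 'n \<Rightarrow> (quat ^ 'n \<Rightarrow> complex) \<Rightarrow> quat ^ 'n \<Rightarrow> complex" where
  "left_act g f h = f (matrix_inv g *v h)"

definition right_act ::
    "quat \<Rightarrow> (quat ^ 'n \<Rightarrow> complex) \<Rightarrow> quat ^ 'n \<Rightarrow> complex" where
  "right_act q f h = f (\<chi> i. h $ i * q)"

definition bi_invariant :: "(quat ^ ('n :: {finite, linorder}) \<Rightarrow> complex) \<Rightarrow> bool" where
  "bi_invariant f \<longleftrightarrow>
     (\<forall>g\<in>one_times_Sp. left_act g f = f) \<and> (\<forall>q\<in>Sp1. right_act q f = f)"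

lemma right_mult_coordinates:
  "Quat z w * Quat a b = Quat (a * z - b * cnj w) (a * w + b * cnj z)"
  by (simp add: quat_eq_iff algebra_simps)

lemma one_times_Sp_iff:
  fixes g :: "quat ^ ('n :: {finite, linorder}) ^ ('n :: {finite, linorder})"
  defines "o1 \<equiv> Min (UNIV :: 'n set)"
  assumes block: "g $ o1 $ o1 = 1" "\<And>i. i \<noteq> o1 \<Longrightarrow> g $ o1 $ i = 0" "\<And>i. i \<noteq> o1 \<Longrightarrow> g $ i $ o1 = 0"
  shows "g \<in> one_times_Sp \<longleftrightarrow>
    (\<forall>h. (\<Sum>i\<in>-{o1}. (norm (\<Sum>j\<in>-{o1}. g $ i $ j * h $ j))\<^sup>2) = (\<Sum>i\<in>-{o1}. (norm (h $ i))\<^sup>2))"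
proof -
  have split: "sum f UNIV = f o1 + sum f (-{o1})" for f :: "'n \<Rightarrow> 'b :: comm_monoid_add"
    using sum.remove[of UNIV o1 f] by (simp only: Compl_eq_Diff_UNIV finite UNIV_I)
  have nsq: "(norm h)\<^sup>2 = (norm (h $ o1))\<^sup>2 + (\<Sum>i\<in>-{o1}. (norm (h $ i))\<^sup>2)"
    for h :: "(quat, 'n) vec"
  proof -
    have "(norm h)\<^sup>2 = (\<Sum>i\<in>UNIV. (norm (h $ i))\<^sup>2)"
      by (simp add: norm_vec_def L2_set_def sum_nonneg)
    then show ?thesis
      by (simp only: split)
  qed
  have mv: "(g *v h) $ i = g $ i $ o1 * h $ o1 + (\<Sum>j\<in>-{o1}. g $ i $ j * h $ j)" for h i
    unfolding matrix_vector_mult_def by (simp only: split vec_lambda_beta)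
  have first: "(g *v h) $ o1 = h $ o1" for h
    using block by (simp add: mv)
  have rest: "(g *v h) $ i = (\<Sum>j\<in>-{o1}. g $ i $ j * h $ j)" if "i \<noteq> o1" for h i
    using block that by (simp add: mv)
  have "norm (g *v h) = norm h \<longleftrightarrow>
      (\<Sum>i\<in>-{o1}. (norm (\<Sum>j\<in>-{o1}. g $ i $ j * h $ j))\<^sup>2) = (\<Sum>i\<in>-{o1}. (norm (h $ i))\<^sup>2)" for h
  proof -
    have "norm (g *v h) = norm h \<longleftrightarrow> (norm (g *v h))\<^sup>2 = (norm h)\<^sup>2"
      by simp
    moreover have "(\<Sum>i\<in>-{o1}. (norm ((g *v h) $ i))\<^sup>2)
        = (\<Sum>i\<in>-{o1}. (norm (\<Sum>j\<in>-{o1}. g $ i $ j * h $ j))\<^sup>2)"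
      by (intro sum.cong) (simp_all add: rest)
    ultimately show ?thesis
      by (simp add: nsq first)
  qed
  then show ?thesis
    using block by (simp add: one_times_Sp_def Sp_def o1_def)
qed


section \<open>The curve and its parametrisation\<close>

definition curve :: "real \<Rightarrow> quat ^ ('n :: {finite, linorder})" where
  "curve \<theta> = (\<chi> i. if i = Min UNIV then Quat (of_real (cos \<theta>)) 0
                  else if i = Max UNIV then Quat (of_real (sin \<theta>)) 0 else 0)"

text \<open>For open sets of reals; only then does \<^const>\<open>deriv\<close> depend on the values on the set alone.\<close>

definition smooth_diffeomorphism :: "real set \<Rightarrow> real set \<Rightarrow> (real \<Rightarrow> real) \<Rightarrow> bool" where
  "smooth_diffeomorphism S T f \<longleftrightarrow> bij_betw f S T \<and>
     (\<forall>m. \<forall>x\<in>S. (deriv ^^ m) f differentiable (at x)) \<and>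
     (\<forall>m. \<forall>y\<in>T. (deriv ^^ m) (inv_into S f) differentiable (at y))"

end

theory Submission
  imports Defs
begin

text \<open>
  Transitivity of \<open>Sp(n-1)\<close> on spheres (realised by quaternionic reflections \<open>1 + v \<mu> v\<^sup>*\<close>) and the
  right action of \<open>Sp(1)\<close> show that a bi-invariant \<open>P\<close> takes the same value at any two points
  \<open>h\<close> with the same \<open>|h|\<close> and \<open>|h\<^sub>1|\<close>. Hence \<open>P\<close> is constant along circles through \<open>x(\<theta>)\<close> which
  rotate one of its two coordinates \<open>cos \<theta>\<close>, \<open>sin \<theta>\<close> into a direction orthogonal to the plane of the curve.
  Differentiating twice along such a circle of radius \<open>r\<close> expresses the pure second derivative of
  \<open>P\<close> in that direction as \<open>1/r\<close> times a radial derivative, so the Laplacian at \<open>x(\<theta>)\<close> only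
  involves derivatives in the plane of the curve. Euler's identities for the
  homogeneous \<open>P\<close> turn these into \<open>F\<close>, \<open>F'\<close> and \<open>F''\<close>. The substitution \<open>\<tau> = cos\<^sup>2 \<theta>\<close>
  gives the hypergeometric equation.
\<close>

section \<open>Quaternionic reflections and bi-invariance\<close>

instance quat :: real_algebra_1
  by standard (simp_all add: quat_eq_iff scaleR_conv_of_real algebra_simps)

text \<open>Since \<open>j b = cnj b j\<close>, the conjugate of \<open>a + j b\<close> is
  \<open>cnj a - j b\<close>; only the first component gets a complex conjugation.\<close>

definition qcnj :: "quat \<Rightarrow> quat" where
  "qcnj q = Quat (cnj (zpart q)) (- wpart q)"

lemma qcnj_sel [simp]: "zpart (qcnj q) = cnj (zpart q)" "wpart (qcnj q) = - wpart q"
  by (simp_all add: qcnj_def)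

lemma qcnj_qcnj [simp]: "qcnj (qcnj q) = q"
  by (simp add: quat_eq_iff)

lemma norm_quat_squared: "(norm q)\<^sup>2 = (cmod (zpart q))\<^sup>2 + (cmod (wpart q))\<^sup>2" for q :: quat
  by (simp add: norm_quat_def inner_quat_def power2_norm_eq_inner)

lemma norm_qcnj [simp]: "norm (qcnj q) = norm q"
  by (simp add: norm_quat_def inner_quat_def inner_complex_def)

lemma mult_qcnj: "q * qcnj q = (norm q)\<^sup>2 *\<^sub>R 1" "qcnj q * q = (norm q)\<^sup>2 *\<^sub>R 1"
  by (simp_all add: quat_eq_iff norm_quat_squared complex_eq_iff cmod_power2)
    (simp_all add: power2_eq_square algebra_simps)

lemma inner_mult_left_quat: "inner p (q * r) = inner (qcnj q * p) r" for p q r :: quat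
  by (simp add: inner_quat_def inner_complex_def algebra_simps)

lemma inner_mult_right_quat: "inner p (q * r) = inner (p * qcnj r) q" for p q r :: quat
  by (simp add: inner_quat_def inner_complex_def algebra_simps)

lemma inner_one_quat: "inner 1 q = Re (zpart q)" "inner q 1 = Re (zpart q)" for q :: quat
  by (simp_all add: inner_quat_def inner_complex_def)

lemma norm_mult_quat: "norm (p * q) = norm p * norm q" for p q :: quat
proof -
  have "(norm (p * q))\<^sup>2 = inner (qcnj p * p * q) q"
    by (simp add: power2_norm_eq_inner inner_mult_left_quat mult.assoc)
  also have "\<dots> = (norm p * norm q)\<^sup>2"
    by (simp add: mult_qcnj power_mult_distrib power2_norm_eq_inner)
  finally show ?thesis
    by simp
qed

text \<open>The quaternionic Hermitian form, conjugated in the first argument so that it is linear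
  over right scalars in the second.\<close>

definition qdot :: "quat ^ 'n \<Rightarrow> quat ^ 'n \<Rightarrow> quat" where
  "qdot v h = (\<Sum>i\<in>UNIV. qcnj (v $ i) * h $ i)"

lemma qdot_self: "qdot v v = (norm v)\<^sup>2 *\<^sub>R 1"
proof -
  have "(norm v)\<^sup>2 = (\<Sum>i\<in>UNIV. (norm (v $ i))\<^sup>2)"
    by (simp add: norm_vec_def L2_set_def sum_nonneg)
  then show ?thesis
    by (simp add: qdot_def mult_qcnj scaleR_sum_left)
qed

lemma inner_right_mult_vec: "inner h (\<chi> i. v $ i * m) = inner (qdot v h) m"
  by (simp add: inner_vec_def qdot_def inner_sum_left inner_mult_left_quat)

lemma Re_qdot: "Re (zpart (qdot v h)) = inner v h"
  using inner_right_mult_vec[of h v 1] by (simp add: inner_one_quat inner_commute)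

lemma norm_right_mult_vec: "norm (\<chi> i. v $ i * m) = norm v * norm m"
  for v :: "quat ^ 'n"
  by (simp add: norm_vec_def norm_mult_quat L2_set_left_distrib)

text \<open>This matrix fixes every \<open>h\<close> with \<open>qdot v h = 0\<close> and sends
  \<open>v\<close> to \<open>v (1 + |v|^2 \<mu>)\<close>. The parameter stands between
  \<open>v\<close> and its conjugate because scalars act from the right and matrices from the
  left.\<close>

definition qreflection :: "quat ^ 'n \<Rightarrow> quat \<Rightarrow> quat ^ 'n ^ 'n" where
  "qreflection v \<mu> = (\<chi> i j. (if i = j then 1 else 0) + v $ i * \<mu> * qcnj (v $ j))"

lemma qreflection_mult_vec: "qreflection v \<mu> *v h = h + (\<chi> i. v $ i * (\<mu> * qdot v h))"
  by (simp add: vec_eq_iff qreflection_def matrix_vector_mult_def qdot_def sum.distrib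
      distrib_right sum_distrib_left mult.assoc mult_delta_left)

text \<open>For nonzero \<open>v\<close> the hypothesis says that \<open>1 + |v|^2 \<mu>\<close> is
  a unit quaternion. The cross term and the square of the added vector are both multiples of
  \<open>|qdot v h|^2\<close>, and the hypothesis makes them cancel.\<close>

lemma norm_qreflection:
  assumes "2 * Re (zpart \<mu>) + (norm v)\<^sup>2 * (norm \<mu>)\<^sup>2 = 0"
  shows "norm (qreflection v \<mu> *v h) = norm h"
proof -
  define d where "d = qdot v h"
  have "(norm (qreflection v \<mu> *v h))\<^sup>2
      = (norm h)\<^sup>2 + 2 * inner d (\<mu> * d) + (norm v * norm (\<mu> * d))\<^sup>2"
    by (simp add: qreflection_mult_vec d_def power2_norm_eq_inner inner_add_left inner_add_right
        inner_commute flip: norm_right_mult_vec inner_right_mult_vec)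
  also have "inner d (\<mu> * d) = (norm d)\<^sup>2 * Re (zpart \<mu>)"
    by (simp add: inner_mult_right_quat mult_qcnj inner_one_quat)
  also have "(norm h)\<^sup>2 + 2 * ((norm d)\<^sup>2 * Re (zpart \<mu>)) + (norm v * norm (\<mu> * d))\<^sup>2
      = (norm h)\<^sup>2 + (norm d)\<^sup>2 * (2 * Re (zpart \<mu>) + (norm v)\<^sup>2 * (norm \<mu>)\<^sup>2)"
    by (simp add: norm_mult_quat power_mult_distrib algebra_simps)
  finally show ?thesis
    using assms by simp
qed

text \<open>Expanding the product leaves one correction term, whose middle factor is the real number
  that the hypothesis sets to 0. An explicit inverse is wanted because \<open>left_act\<close> acts
  through \<open>matrix_inv\<close>.\<close>

lemma qreflection_mult_qcnj:
  assumes "2 * Re (zpart \<mu>) + (norm v)\<^sup>2 * (norm \<mu>)\<^sup>2 = 0"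
  shows "qreflection v \<mu> ** qreflection v (qcnj \<mu>) = mat 1"
proof -
  have z: "\<mu> + qcnj \<mu> + (norm v)\<^sup>2 *\<^sub>R (\<mu> * qcnj \<mu>) = 0"
    using assms
    by (simp add: mult_qcnj quat_eq_iff complex_eq_iff)
  have "(qreflection v \<mu> ** qreflection v (qcnj \<mu>)) $ i $ j
      = (if i = j then 1 else 0)
        + v $ i * (\<mu> + qcnj \<mu> + \<mu> * qdot v v * qcnj \<mu>) * qcnj (v $ j)" for i j
    by (simp add: qreflection_def matrix_matrix_mult_def qdot_def sum.distrib
      distrib_right distrib_left sum_distrib_left sum_distrib_right mult.assoc
      mult_delta_left mult_delta_right add.assoc)
  moreover have "\<mu> + qcnj \<mu> + \<mu> * qdot v v * qcnj \<mu> = 0"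
    using z by (simp add: qdot_self)
  ultimately show ?thesis
    by (simp add: vec_eq_iff mat_def)
qed

lemma qreflection_in_one_times_Sp:
  assumes "2 * Re (zpart \<mu>) + (norm v)\<^sup>2 * (norm \<mu>)\<^sup>2 = 0" "v $ Min UNIV = 0"
  shows "qreflection v \<mu> \<in> one_times_Sp"
proof -
  have "qreflection v \<mu> \<in> Sp"
    using assms by (simp add: Sp_def norm_qreflection)
  moreover have "qcnj 0 = 0"
    by (simp add: quat_eq_iff)
  ultimately show ?thesis
    using assms by (simp add: one_times_Sp_def) (simp add: qreflection_def)
qed

section \<open>Bi-invariant functions depend only on \<open>|h|\<close> and the norm of the first
  coordinate\<close>

lemma matrix_inv_eqI:
  fixes A B :: "'a :: semiring_1 ^ 'n ^ 'n"
  assumes "A ** B = mat 1" "B ** A = mat 1"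
  shows "matrix_inv A = B"
proof -
  have "A ** matrix_inv A = mat 1"
    unfolding matrix_inv_def using assms by (rule_tac someI2[of _ B]) auto
  then have "B ** A ** matrix_inv A = B"
    by (simp flip: matrix_mul_assoc)
  then show ?thesis
    by (simp add: assms)
qed

text \<open>The reflection along \<open>v = x - y\<close> with \<open>\<mu>\<close> equal to minus
  the inverse of \<open>qdot v x\<close> carries \<open>x\<close> to \<open>x - v = y\<close>. Equal
  norms make it an isometry, and equal first coordinates place it in
  \<open>one_times_Sp\<close>.\<close>

lemma bi_invariant_left:
  fixes f :: "quat ^ ('n :: {finite, linorder}) \<Rightarrow> complex"
  assumes f: "bi_invariant f" and "x $ Min UNIV = y $ Min UNIV" "norm x = norm y"
  shows "f x = f y"
proof (cases "x = y")
  case False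
  define v where "v = x - y"
  define c where "c = qdot v x"
  define \<mu> where "\<mu> = (- inverse ((norm c)\<^sup>2)) *\<^sub>R qcnj c"
  have v: "v $ Min UNIV = 0"
    using assms by (simp add: v_def)
  \<comment> \<open>As \<open>|x| = |y|\<close>, both sides equal
    \<open>2 |x|^2 - 2 inner x y\<close>.\<close>
  have Re_c: "2 * Re (zpart c) = (norm v)\<^sup>2"
    using assms(3) unfolding c_def Re_qdot v_def power2_norm_eq_inner norm_eq
    by (simp add: inner_diff_left inner_diff_right inner_commute)
  then have "c \<noteq> 0"
    using False by (auto simp: v_def)
  then have \<mu>: "2 * Re (zpart \<mu>) + (norm v)\<^sup>2 * (norm \<mu>)\<^sup>2 = 0"
    by (simp add: \<mu>_def power_mult_distrib flip: Re_c) (simp add: field_simps power2_eq_square)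
  then have \<mu>': "2 * Re (zpart (qcnj \<mu>)) + (norm v)\<^sup>2 * (norm (qcnj \<mu>))\<^sup>2 = 0"
    by simp
  \<comment> \<open>The left action inverts its matrix, so the conjugate parameter is fed in for
    \<open>\<mu>\<close> to come out.\<close>
  have "matrix_inv (qreflection v (qcnj \<mu>)) = qreflection v \<mu>"
    using qreflection_mult_qcnj[OF \<mu>] qreflection_mult_qcnj[OF \<mu>'] by (intro matrix_inv_eqI) simp_all
  moreover have "left_act (qreflection v (qcnj \<mu>)) f = f"
    using f qreflection_in_one_times_Sp[OF \<mu>' v] by (simp add: bi_invariant_def)
  ultimately have "f (qreflection v \<mu> *v x) = f x"
    by (metis left_act_def)
  moreover have "\<mu> * c = - 1"
    using \<open>c \<noteq> 0\<close> by (simp add: \<mu>_def mult_qcnj)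
  then have "qreflection v \<mu> *v x = y"
    by (simp add: qreflection_mult_vec vec_eq_iff flip: c_def) (simp add: v_def)
  ultimately show ?thesis
    by simp
qed simp

text \<open>Right multiplication by a unit quaternion keeps the norm and can turn the first
  coordinate of \<open>x\<close> into that of \<open>y\<close>; then
  \<open>bi_invariant_left\<close> applies.\<close>

lemma bi_invariant_eqI:
  fixes f :: "quat ^ ('n :: {finite, linorder}) \<Rightarrow> complex"
  assumes f: "bi_invariant f"
    and n1: "norm (x $ Min UNIV) = norm (y $ Min UNIV)" and "norm x = norm y"
  shows "f x = f y"
proof -
  define a b where "a = x $ Min UNIV" and "b = y $ Min UNIV"
  obtain q where q: "norm q = 1" "a * q = b"
  proof (cases "a = 0")
    case True
    then show ?thesis
      using n1 that[of 1] by (simp add: a_def b_def norm_eq_sqrt_inner inner_one_quat)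
  next
    case False
    then have "b \<noteq> 0"
      using n1 by (auto simp: a_def b_def)
    show ?thesis
    \<comment> \<open>The witness is the inverse of \<open>a\<close> times \<open>b\<close>, a unit
      because \<open>a\<close> and \<open>b\<close> have the same norm.\<close>
    proof (rule that[of "inverse ((norm a)\<^sup>2) *\<^sub>R (qcnj a * b)"])
      show "norm (inverse ((norm a)\<^sup>2) *\<^sub>R (qcnj a * b)) = 1"
        using \<open>b \<noteq> 0\<close> n1 by (simp add: norm_mult_quat field_simps power2_eq_square flip: a_def b_def)
      show "a * inverse ((norm a)\<^sup>2) *\<^sub>R (qcnj a * b) = b"
        using False by (simp add: mult_qcnj flip: mult.assoc)
    qed
  qed
  have "right_act q f = f"
    using f q by (simp add: bi_invariant_def Sp1_def)
  then have "f x = f (\<chi> i. x $ i * q)"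
    by (metis right_act_def)
  also have "\<dots> = f y"
    using q assms by (intro bi_invariant_left[OF f]) (simp_all add: a_def b_def norm_right_mult_vec)
  finally show ?thesis .
qed

section \<open>Directional derivatives of polynomials\<close>

text \<open>The direction comes first, so that \<open>dird v f\<close> is again a function on the
  space and can be differentiated further.\<close>

definition dird :: "'a::real_normed_vector \<Rightarrow> ('a \<Rightarrow> 'b::real_normed_vector) \<Rightarrow> 'a \<Rightarrow> 'b" where
  "dird v f = (\<lambda>y. frechet_derivative f (at y) v)"

lemma dird_eqI: "(f has_derivative f') (at y) \<Longrightarrow> dird v f y = f' v"
  by (simp add: dird_def flip: frechet_derivative_at)

lemma has_derivative_dird:
  fixes f :: "'a::euclidean_space \<Rightarrow> 'b::euclidean_space"
  assumes "polynomial_function f"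
  shows "(f has_derivative (\<lambda>v. dird v f y)) (at y)"
  using differentiable_at_polynomial_function[OF assms] unfolding dird_def
  by (simp add: frechet_derivative_works[symmetric])

text \<open>Keeps iterated derivatives among the polynomials, so that second directional derivatives
  exist at every point.\<close>

lemma real_polynomial_function_dird:
  fixes f :: "'a::euclidean_space \<Rightarrow> real"
  assumes "real_polynomial_function f"
  shows "real_polynomial_function (dird v f)"
proof -
  have D: "(g has_derivative (\<lambda>v. dird v g y)) (at y)" if "real_polynomial_function g"
    for g :: "'a \<Rightarrow> real" and y
    using that by (simp add: has_derivative_dird real_polynomial_function_eq)
  show ?thesis
    using assms
  proof induction
    case (linear f)
    have "dird v f = (\<lambda>_. f v)"
      by (intro ext dird_eqI bounded_linear_imp_has_derivative linear)
    then show ?case by auto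
  next
    case (const c)
    have "dird v (\<lambda>_::'a. c) = (\<lambda>_. 0)"
      by (intro ext) (subst dird_eqI[OF has_derivative_const], simp)
    then show ?case by auto
  next
    case (add f g)
    have "dird v (\<lambda>x. f x + g x) = (\<lambda>y. dird v f y + dird v g y)"
      by (intro ext) (subst dird_eqI[OF has_derivative_add[OF D D]], use add in auto)
    then show ?case using add by auto
  next
    case (mult f g)
    have "dird v (\<lambda>x. f x * g x) = (\<lambda>y. f y * dird v g y + dird v f y * g y)"
      by (intro ext) (subst dird_eqI[OF has_derivative_mult[OF D D]], use mult in auto)
    then show ?case using mult by auto
  qed
qed

lemma polynomial_function_dird:
  fixes f :: "'a::euclidean_space \<Rightarrow> 'b::euclidean_space"
  assumes "polynomial_function f"
  shows "polynomial_function (dird v f)"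
  unfolding polynomial_function_iff_Basis_inner
proof
  fix b :: 'b
  assume "b \<in> Basis"
  then have "real_polynomial_function (dird v (\<lambda>x. f x \<bullet> b))"
    using assms by (auto simp: polynomial_function_iff_Basis_inner intro: real_polynomial_function_dird)
  moreover have "dird v (\<lambda>x. f x \<bullet> b) = (\<lambda>y. dird v f y \<bullet> b)"
    by (intro ext dird_eqI has_derivative_inner_left has_derivative_dird assms)
  ultimately show "real_polynomial_function (\<lambda>y. dird v f y \<bullet> b)"
    by simp
qed

lemma dird_linear_combination:
  fixes f :: "'a::euclidean_space \<Rightarrow> 'b::euclidean_space"
  assumes "polynomial_function f"
  shows "dird (a *\<^sub>R p + b *\<^sub>R q) f = (\<lambda>y. a *\<^sub>R dird p f y + b *\<^sub>R dird q f y)"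
proof
  fix y
  interpret linear "\<lambda>v. dird v f y"
    using has_derivative_dird[OF assms] by (rule has_derivative_linear)
  show "dird (a *\<^sub>R p + b *\<^sub>R q) f y = a *\<^sub>R dird p f y + b *\<^sub>R dird q f y"
    by (simp add: add scale)
qed

lemma dird_dird_linear_combination:
  fixes f :: "'a::euclidean_space \<Rightarrow> 'b::euclidean_space"
  assumes f: "polynomial_function f"
  shows "dird v (dird (a *\<^sub>R p + b *\<^sub>R q) f) y
    = a *\<^sub>R dird v (dird p f) y + b *\<^sub>R dird v (dird q f) y"
  unfolding dird_linear_combination[OF f]
  by (intro dird_eqI has_derivative_add has_derivative_scaleR_right has_derivative_dird
      polynomial_function_dird f)

section \<open>Polynomials along ellipses\<close>

lemma has_vector_derivative_polynomial_curve:
  fixes f :: "'a::euclidean_space \<Rightarrow> 'b::euclidean_space"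
  assumes "polynomial_function f" "(\<gamma> has_vector_derivative \<gamma>') (at t)"
  shows "((\<lambda>t. f (\<gamma> t)) has_vector_derivative dird \<gamma>' f (\<gamma> t)) (at t)"
  using vector_derivative_diff_chain_within[OF assms(2) has_derivative_at_withinI]
    has_derivative_dird[OF assms(1), of "\<gamma> t"]
  by (simp add: o_def)

text \<open>Serves two purposes: with \<open>c = 0\<close> it is the curve of the theorem, and with
  one part of a point as centre \<open>c\<close> it is the circle that rotates the other
  part.\<close>

definition ellipse :: "'a::real_vector \<Rightarrow> 'a \<Rightarrow> 'a \<Rightarrow> real \<Rightarrow> 'a" where
  "ellipse c p q t = c + cos t *\<^sub>R p + sin t *\<^sub>R q"

lemma has_vector_derivative_ellipse:
  "(ellipse c p q has_vector_derivative (- sin t) *\<^sub>R p + cos t *\<^sub>R q) (at t)"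
  unfolding ellipse_def [abs_def] by (auto intro!: derivative_eq_intros)

lemma has_vector_derivative_along_ellipse:
  fixes f :: "'a::euclidean_space \<Rightarrow> 'b::euclidean_space"
  assumes f: "polynomial_function f"
  shows "((\<lambda>t. f (ellipse c p q t)) has_vector_derivative
      (- sin t) *\<^sub>R dird p f (ellipse c p q t) + cos t *\<^sub>R dird q f (ellipse c p q t)) (at t)"
  using has_vector_derivative_polynomial_curve[OF f has_vector_derivative_ellipse]
  by (simp only: dird_linear_combination[OF f])

lemma has_vector_derivative2_along_ellipse:
  fixes f :: "'a::euclidean_space \<Rightarrow> 'b::euclidean_space"
  assumes f: "polynomial_function f"
  shows "((\<lambda>t. (- sin t) *\<^sub>R dird p f (ellipse c p q t) + cos t *\<^sub>R dird q f (ellipse c p q t)) has_vector_derivative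
      (sin t)\<^sup>2 *\<^sub>R dird p (dird p f) (ellipse c p q t)
      - (sin t * cos t) *\<^sub>R (dird q (dird p f) (ellipse c p q t) + dird p (dird q f) (ellipse c p q t))
      + (cos t)\<^sup>2 *\<^sub>R dird q (dird q f) (ellipse c p q t)
      - cos t *\<^sub>R dird p f (ellipse c p q t) - sin t *\<^sub>R dird q f (ellipse c p q t)) (at t)"
  by (rule has_vector_derivative_eq_rhs,
      rule has_vector_derivative_add[OF has_vector_derivative_scaleR has_vector_derivative_scaleR],
      (rule has_vector_derivative_along_ellipse polynomial_function_dird f | rule derivative_intros | rule refl)+)
     (simp add: algebra_simps power2_eq_square)

text \<open>At parameter 0 the velocity is \<open>q\<close> and the acceleration is
  \<open>- p\<close>, so the second derivative of the constant function \<open>f\<close> along the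
  ellipse is the difference of the two sides.\<close>

lemma dird_dird_of_constant_along_ellipse:
  fixes f :: "'a::euclidean_space \<Rightarrow> 'b::euclidean_space"
  assumes f: "polynomial_function f" and "\<And>t. f (ellipse c p q t) = f (c + p)"
  shows "dird q (dird q f) (c + p) = dird p f (c + p)"
proof -
  \<comment> \<open>The first derivative vanishes at every \<open>t\<close>, not only at 0, and can
    therefore be differentiated again.\<close>
  have zero: "(- sin t) *\<^sub>R dird p f (ellipse c p q t) + cos t *\<^sub>R dird q f (ellipse c p q t) = 0" for t
    using has_vector_derivative_along_ellipse[OF f, of c p q t, unfolded assms(2)]
      has_vector_derivative_const
    by (rule vector_derivative_unique_at)
  then have "((\<lambda>t. 0) has_vector_derivative dird q (dird q f) (c + p) - dird p f (c + p)) (at 0)"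
    using has_vector_derivative2_along_ellipse[OF f, where c = c and p = p and q = q and t = 0, unfolded zero] by (simp add: ellipse_def)
  then have "dird q (dird q f) (c + p) - dird p f (c + p) = 0"
    using has_vector_derivative_const by (rule vector_derivative_unique_at)
  then show ?thesis
    by simp
qed

section \<open>Euler's identities\<close>

lemma euler_homogeneous:
  fixes f :: "'a::euclidean_space \<Rightarrow> 'b::euclidean_space"
  assumes f: "polynomial_function f" and hom: "\<And>t x. f (t *\<^sub>R x) = t ^ k *\<^sub>R f x"
  shows "dird x f x = real k *\<^sub>R f x"
proof -
  have "((\<lambda>t. f (t *\<^sub>R x)) has_vector_derivative dird x f (1 *\<^sub>R x)) (at 1)"
    by (rule has_vector_derivative_polynomial_curve[OF f]) (auto intro!: derivative_eq_intros)
  moreover have "((\<lambda>t. f (t *\<^sub>R x)) has_vector_derivative real k *\<^sub>R f x) (at 1)"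
    unfolding hom by (auto intro!: derivative_eq_intros)
  ultimately show ?thesis
    using vector_derivative_unique_at by fastforce
qed

text \<open>With \<open>D\<close> the derivative in the fixed direction \<open>x\<close>, the
  identity \<open>t (D f)(t x) = k t^k f(x)\<close> is differentiated at \<open>t = 1\<close>. The
  extra factor \<open>t\<close> avoids the exponent \<open>k - 1\<close>, so \<open>k = 0\<close> is
  no exception.\<close>

lemma euler_homogeneous2:
  fixes f :: "'a::euclidean_space \<Rightarrow> 'b::euclidean_space"
  assumes f: "polynomial_function f" and hom: "\<And>t x. f (t *\<^sub>R x) = t ^ k *\<^sub>R f x"
  shows "dird x (dird x f) x = (real k * (real k - 1)) *\<^sub>R f x"
proof -
  have eq: "t *\<^sub>R dird x f (t *\<^sub>R x) = (real k * t ^ k) *\<^sub>R f x" for t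
    using euler_homogeneous[OF assms, of "t *\<^sub>R x"] dird_linear_combination[OF f, of t x 0 x]
    by (simp add: hom)
  have "((\<lambda>t. t *\<^sub>R dird x f (t *\<^sub>R x)) has_vector_derivative
      dird x (dird x f) (1 *\<^sub>R x) + dird x f (1 *\<^sub>R x)) (at 1)"
    by (rule has_vector_derivative_eq_rhs, rule has_vector_derivative_scaleR[OF DERIV_ident],
        rule has_vector_derivative_polynomial_curve[OF polynomial_function_dird[OF f], where \<gamma>' = x])
       (auto intro!: derivative_eq_intros)
  moreover have "((\<lambda>t. t *\<^sub>R dird x f (t *\<^sub>R x)) has_vector_derivative (real k * real k) *\<^sub>R f x) (at 1)"
    unfolding eq by (auto intro!: derivative_eq_intros)
  ultimately show ?thesis
    using vector_derivative_unique_at[of _ "dird x (dird x f) x + dird x f x" 1 "(real k * real k) *\<^sub>R f x"]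
    by (simp add: euler_homogeneous[OF assms] algebra_simps)
qed

lemma laplacian_dird: "laplacian f x = (\<Sum>b\<in>Basis. dird b (dird b f) x)"
  by (simp add: laplacian_def dird_def)

section \<open>The substitution \<open>\<tau> = cos\<^sup>2 \<theta>\<close>\<close>

text \<open>The span of \<open>1\<close>, \<open>cos (2 * \<theta>)\<close> and
  \<open>sin (2 * \<theta>)\<close> contains the squared cosine and is closed under
  differentiation.\<close>

lemma funpow_deriv_cos_squared:
  "\<exists>a b c. (deriv ^^ m) (\<lambda>\<theta>::real. (cos \<theta>)\<^sup>2) = (\<lambda>\<theta>. a + b * cos (2 * \<theta>) + c * sin (2 * \<theta>))"
proof (induction m)
  case 0
  have "(\<lambda>\<theta>::real. (cos \<theta>)\<^sup>2) = (\<lambda>\<theta>. 1/2 + 1/2 * cos (2 * \<theta>) + 0 * sin (2 * \<theta>))"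
    by (intro ext) (simp only: cos_double_cos, simp add: diff_divide_distrib)
  then show ?case
    unfolding funpow_0 by (intro exI)
next
  case (Suc m)
  then obtain a b c where
    eq: "(deriv ^^ m) (\<lambda>\<theta>::real. (cos \<theta>)\<^sup>2) = (\<lambda>\<theta>. a + b * cos (2 * \<theta>) + c * sin (2 * \<theta>))"
    by blast
  have "deriv (\<lambda>\<theta>. a + b * cos (2 * \<theta>) + c * sin (2 * \<theta>))
      = (\<lambda>\<theta>. 0 + 2 * c * cos (2 * \<theta>) + (- 2 * b) * sin (2 * \<theta>))"
    by (intro ext DERIV_imp_deriv) (auto intro!: derivative_eq_intros)
  then show ?case
    unfolding funpow.simps o_apply eq by (intro exI)
qed

section \<open>The inverse of the substitution and all its derivatives\<close>

lemma cos_squared_bij: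
  defines "\<psi> \<equiv> \<lambda>\<theta>::real. (cos \<theta>)\<^sup>2"
  shows "bij_betw \<psi> {0<..<pi / 2} {0<..<1}"
    and "\<And>\<tau>. \<tau> \<in> {0<..<1} \<Longrightarrow> inv_into {0<..<pi / 2} \<psi> \<tau> = arccos (sqrt \<tau>)"
proof -
  have maps: "\<psi> \<theta> \<in> {0<..<1}" "arccos (sqrt (\<psi> \<theta>)) = \<theta>" if "\<theta> \<in> {0<..<pi / 2}" for \<theta>
  proof -
    have "0 < cos \<theta>" "0 < sin \<theta>"
      using that by (auto intro: cos_gt_zero sin_gt_zero)
    moreover from this have "(cos \<theta>)\<^sup>2 < 1"
      by (simp add: cos_squared_eq)
    ultimately show "\<psi> \<theta> \<in> {0<..<1}" "arccos (sqrt (\<psi> \<theta>)) = \<theta>"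
      using that by (auto simp: \<psi>_def arccos_cos)
  qed
  have inv: "arccos (sqrt \<tau>) \<in> {0<..<pi / 2}" "\<psi> (arccos (sqrt \<tau>)) = \<tau>" if "\<tau> \<in> {0<..<1}" for \<tau>
  proof -
    have s: "0 < sqrt \<tau>" "sqrt \<tau> < 1"
      using that by auto
    moreover have ge: "- 1 \<le> sqrt \<tau>"
      by (rule order.trans[of _ 0]) (use that in simp_all)
    ultimately show "arccos (sqrt \<tau>) \<in> {0<..<pi / 2}"
      using arccos_less_arccos[of 0 "sqrt \<tau>"] arccos_less_arccos[of "sqrt \<tau>" 1] by simp
    have "cos (arccos (sqrt \<tau>)) = sqrt \<tau>"
      using s ge by (intro cos_arccos) auto
    then show "\<psi> (arccos (sqrt \<tau>)) = \<tau>"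
      using that by (simp add: \<psi>_def)
  qed
  show bij: "bij_betw \<psi> {0<..<pi / 2} {0<..<1}"
    using maps inv by (intro bij_betwI[where g = "\<lambda>\<tau>. arccos (sqrt \<tau>)"]) auto
  show "inv_into {0<..<pi / 2} \<psi> \<tau> = arccos (sqrt \<tau>)" if "\<tau> \<in> {0<..<1}" for \<tau>
    using inv[OF that] bij by (intro inv_into_f_eq) (auto simp: bij_betw_def)
qed

lemma DERIV_arccos_sqrt:
  assumes "0 < \<tau>" "\<tau> < 1"
  shows "((\<lambda>\<tau>. arccos (sqrt \<tau>)) has_real_derivative - 1 / (2 * sqrt (\<tau> * (1 - \<tau>)))) (at \<tau>)"
proof -
  have "- 1 < sqrt \<tau>"
    using assms real_sqrt_ge_zero[of \<tau>] by linarith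
  then have "((\<lambda>\<tau>. arccos (sqrt \<tau>)) has_real_derivative
      inverse (- sqrt (1 - (sqrt \<tau>)\<^sup>2)) * (inverse (sqrt \<tau>) / 2)) (at \<tau>)"
    using assms by (intro DERIV_chain2[OF DERIV_arccos DERIV_real_sqrt]) simp_all
  also have "inverse (- sqrt (1 - (sqrt \<tau>)\<^sup>2)) * (inverse (sqrt \<tau>) / 2)
      = - 1 / (2 * sqrt (\<tau> * (1 - \<tau>)))"
    using assms by (simp add: real_sqrt_mult divide_simps)
  finally show ?thesis .
qed

text \<open>With \<open>w = y (1 - y)\<close>, functions \<open>p sqrt(w) / w^j\<close> with
  \<open>p\<close> a polynomial are closed under differentiation, each derivative raising
  \<open>j\<close> by one. The formula is for derivative number \<open>m + 1\<close>, hence the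
  exponent \<open>Suc m\<close>.\<close>

lemma DERIV_funpow_inv_cos_squared:
  defines "g \<equiv> inv_into {0<..<pi / 2} (\<lambda>\<theta>::real. (cos \<theta>)\<^sup>2)"
  shows "\<exists>p. \<forall>y\<in>{0<..<1}. ((deriv ^^ m) g has_real_derivative
           poly p y * sqrt (y * (1 - y)) / (y * (1 - y)) ^ Suc m) (at y)"
proof (induction m)
  case 0
  have "(g has_real_derivative poly [:- 1 / 2:] y * sqrt (y * (1 - y)) / (y * (1 - y)) ^ Suc 0) (at y)"
    if "y \<in> {0<..<1}" for y
  \<comment> \<open>The inverse is known to be \<open>arccos (sqrt \<tau>)\<close> only on the open
    interval, which suffices for a derivative at an interior point.\<close>
  proof (rule has_field_derivative_transform_within_open[where S = "{0<..<1}"])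
    have "sqrt (y * (1 - y)) * sqrt (y * (1 - y)) = y * (1 - y)" "0 < y * (1 - y)"
      using that by (auto intro!: real_sqrt_mult_self)
    then have "- 1 / (2 * sqrt (y * (1 - y))) = poly [:- 1 / 2:] y * sqrt (y * (1 - y)) / (y * (1 - y)) ^ Suc 0"
      using that by (simp add: divide_simps)
    then show "((\<lambda>\<tau>. arccos (sqrt \<tau>)) has_real_derivative
        poly [:- 1 / 2:] y * sqrt (y * (1 - y)) / (y * (1 - y)) ^ Suc 0) (at y)"
      using DERIV_arccos_sqrt[of y] that by simp
  qed (use that in \<open>simp_all add: g_def cos_squared_bij(2)\<close>)
  then show ?case
    unfolding funpow_0 by (intro exI ballI)
next
  case (Suc m)
  then obtain p where p: "\<And>y. y \<in> {0<..<1} \<Longrightarrow> ((deriv ^^ m) g has_real_derivative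
      poly p y * sqrt (y * (1 - y)) / (y * (1 - y)) ^ Suc m) (at y)"
    by blast
  \<comment> \<open>The quotient rule gives \<open>p' w + (1/2 - (m + 1)) p w'\<close>:
    \<open>[:0, 1, - 1:]\<close> is \<open>w\<close>, \<open>[:1, - 2:]\<close> is
    \<open>w'\<close>, the \<open>1/2\<close> stems from the square root and \<open>m + 1\<close>
    from the denominator.\<close>
  define q where "q = pderiv p * [:0, 1, - 1:] + smult (1 / 2 - real (Suc m)) (p * [:1, - 2:])"
  have "((deriv ^^ Suc m) g has_real_derivative
      poly q y * sqrt (y * (1 - y)) / (y * (1 - y)) ^ Suc (Suc m)) (at y)" if y: "y \<in> {0<..<1}" for y
  proof (rule has_field_derivative_transform_within_open[where S = "{0<..<1}"])
    show "poly p x * sqrt (x * (1 - x)) / (x * (1 - x)) ^ Suc m = (deriv ^^ Suc m) g x"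
      if "x \<in> {0<..<1}" for x
      using DERIV_imp_deriv[OF p[OF that]] by simp
    define w where "w = y * (1 - y)"
    have w: "0 < w"
      using y by (simp add: w_def)
    have s: "((\<lambda>x. sqrt (x * (1 - x))) has_real_derivative (1 - 2 * y) * sqrt w / (2 * w)) (at y)"
    proof -
      have "sqrt w * sqrt w = w"
        using w by simp
      then have "inverse (sqrt w) / 2 = sqrt w / (2 * w)"
        using w by (simp add: divide_simps)
      then show ?thesis
        using w unfolding w_def by (auto intro!: derivative_eq_intros simp: field_simps)
    qed
    have v: "((\<lambda>x. (x * (1 - x)) ^ Suc m) has_real_derivative real (Suc m) * w ^ m * (1 - 2 * y)) (at y)"
      unfolding w_def by (rule derivative_eq_intros refl)+ simp
    have "((\<lambda>x. poly p x * sqrt (x * (1 - x)) / (x * (1 - x)) ^ Suc m) has_real_derivative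
        ((poly p y * ((1 - 2 * y) * sqrt w / (2 * w)) + poly (pderiv p) y * sqrt w) * w ^ Suc m
          - poly p y * sqrt w * (real (Suc m) * w ^ m * (1 - 2 * y))) / (w ^ Suc m * w ^ Suc m)) (at y)"
      by (rule DERIV_cong, rule DERIV_divide[OF DERIV_mult[OF poly_DERIV s] v])
         (use w in \<open>simp_all add: mult.commute flip: w_def\<close>)
    also have "((poly p y * ((1 - 2 * y) * sqrt w / (2 * w)) + poly (pderiv p) y * sqrt w) * w ^ Suc m
          - poly p y * sqrt w * (real (Suc m) * w ^ m * (1 - 2 * y))) / (w ^ Suc m * w ^ Suc m)
        = (poly (pderiv p) y * w + (1 / 2 - real (Suc m)) * (poly p y * (1 - 2 * y))) * sqrt w / w ^ Suc (Suc m)"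
      using w by (simp add: field_simps)
    also have "\<dots> = poly q y * sqrt w / w ^ Suc (Suc m)"
      by (simp add: q_def w_def algebra_simps)
    finally show "((\<lambda>x. poly p x * sqrt (x * (1 - x)) / (x * (1 - x)) ^ Suc m) has_real_derivative
        poly q y * sqrt (y * (1 - y)) / (y * (1 - y)) ^ Suc (Suc m)) (at y)"
      by (simp add: w_def)
  qed (use y in simp_all)
  then show ?case
    by (intro exI ballI)
qed

lemma smooth_diffeomorphism_cos_squared:
  "smooth_diffeomorphism {0<..<pi / 2} {0<..<1} (\<lambda>\<theta>. (cos \<theta>)\<^sup>2)"
  unfolding smooth_diffeomorphism_def
proof (intro conjI allI ballI)
  show "bij_betw (\<lambda>\<theta>. (cos \<theta>)\<^sup>2) {0<..<pi / 2} {0<..<1::real}"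
    by (rule cos_squared_bij)
  show "(deriv ^^ m) (\<lambda>\<theta>. (cos \<theta>)\<^sup>2) differentiable at x" for m and x :: real
  proof -
    obtain a b c where "(deriv ^^ m) (\<lambda>\<theta>::real. (cos \<theta>)\<^sup>2) = (\<lambda>\<theta>. a + b * cos (2 * \<theta>) + c * sin (2 * \<theta>))"
      using funpow_deriv_cos_squared by blast
    moreover have "((\<lambda>\<theta>. a + b * cos (2 * \<theta>) + c * sin (2 * \<theta>)) has_real_derivative
        - 2 * b * sin (2 * x) + 2 * c * cos (2 * x)) (at x)"
      by (auto intro!: derivative_eq_intros)
    ultimately show ?thesis
      by (auto simp: real_differentiable_def)
  qed
  show "(deriv ^^ m) (inv_into {0<..<pi / 2} (\<lambda>\<theta>. (cos \<theta>)\<^sup>2)) differentiable at y"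
    if "y \<in> {0<..<1}" for m and y :: real
    using DERIV_funpow_inv_cos_squared[of m] that real_differentiable_def by blast
qed

text \<open>By the chain rule with \<open>g' = - 1 / sin (2 * \<theta>)\<close>, the hypergeometric
  expression at \<open>\<tau>\<close> is one quarter of the trigonometric one at
  \<open>\<theta> = g \<tau>\<close>.\<close>

lemma hypergeometric_of_trigonometric:
  fixes F F' F'' :: "real \<Rightarrow> complex" and n k :: real
  defines "g \<equiv> inv_into {0<..<pi / 2} (\<lambda>\<theta>::real. (cos \<theta>)\<^sup>2)"
  assumes F: "\<And>\<theta>. \<theta> \<in> {0<..<pi / 2} \<Longrightarrow> (F has_vector_derivative F' \<theta>) (at \<theta>)"
    and F': "\<And>\<theta>. \<theta> \<in> {0<..<pi / 2} \<Longrightarrow> (F' has_vector_derivative F'' \<theta>) (at \<theta>)"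
    and ode: "\<And>\<theta>. \<theta> \<in> {0<..<pi / 2} \<Longrightarrow>
      F'' \<theta> + of_real (6 * cot (2 * \<theta>) + (4 * n - 8) / tan \<theta>) * F' \<theta>
        + of_real (k * (k + 4 * n - 2)) * F \<theta> = 0"
  shows "\<exists>\<phi>' \<phi>''. \<forall>\<tau>\<in>{0<..<1}.
    (F \<circ> g has_vector_derivative \<phi>' \<tau>) (at \<tau>) \<and>
    (\<phi>' has_vector_derivative \<phi>'' \<tau>) (at \<tau>) \<and>
    of_real (\<tau> * (1 - \<tau>)) * \<phi>'' \<tau> + of_real (2 * (1 - n * \<tau>)) * \<phi>' \<tau>
      + of_real (k / 2 * (k / 2 + 2 * n - 1)) * (F \<circ> g) \<tau> = 0"
proof -
  \<comment> \<open>\<open>h\<close> is the first derivative of \<open>F \<circ> g\<close>, written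
    in the variable \<open>\<theta>\<close>.\<close>
  define h where "h \<theta> = (- 1 / sin (2 * \<theta>)) *\<^sub>R F' \<theta>" for \<theta>
  define h' where "h' \<theta> = (- 1 / sin (2 * \<theta>)) *\<^sub>R F'' \<theta>
    + (2 * cos (2 * \<theta>) / (sin (2 * \<theta>))\<^sup>2) *\<^sub>R F' \<theta>" for \<theta>
  have h: "(h has_vector_derivative h' \<theta>) (at \<theta>)" if "\<theta> \<in> {0<..<pi / 2}" for \<theta>
  proof -
    have "sin (2 * \<theta>) \<noteq> 0"
      using that sin_gt_zero[of "2 * \<theta>"] by auto
    then have "((\<lambda>\<theta>. - 1 / sin (2 * \<theta>)) has_real_derivative 2 * cos (2 * \<theta>) / (sin (2 * \<theta>))\<^sup>2) (at \<theta>)"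
      by (auto intro!: derivative_eq_intros simp: power2_eq_square)
    from has_vector_derivative_scaleR[OF this F'[OF that]] show ?thesis
      unfolding h_def [abs_def] h'_def .
  qed
  have "(F \<circ> g has_vector_derivative h (g \<tau>)) (at \<tau>) \<and>
    (h \<circ> g has_vector_derivative (- 1 / sin (2 * g \<tau>)) *\<^sub>R h' (g \<tau>)) (at \<tau>) \<and>
    of_real (\<tau> * (1 - \<tau>)) * ((- 1 / sin (2 * g \<tau>)) *\<^sub>R h' (g \<tau>)) + of_real (2 * (1 - n * \<tau>)) * h (g \<tau>)
      + of_real (k / 2 * (k / 2 + 2 * n - 1)) * F (g \<tau>) = 0" if \<tau>: "\<tau> \<in> {0<..<1}" for \<tau>
  proof -
    define \<theta> where "\<theta> = g \<tau>"
    have \<theta>: "\<theta> \<in> {0<..<pi / 2}"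
      using bij_betwE[OF bij_betw_inv_into[OF cos_squared_bij(1)]] \<tau> by (simp add: \<theta>_def g_def)
    have \<tau>_eq: "\<tau> = (cos \<theta>)\<^sup>2"
      using bij_betw_inv_into_right[OF cos_squared_bij(1) \<tau>] by (simp add: \<theta>_def g_def)
    have pos: "0 < cos \<theta>" "0 < sin \<theta>"
      using \<theta> by (auto intro: cos_gt_zero sin_gt_zero)
    have "sqrt (\<tau> * (1 - \<tau>)) = cos \<theta> * sin \<theta>"
      using pos unfolding \<tau>_eq by (simp add: real_sqrt_mult flip: sin_squared_eq)
    then have "2 * sqrt (\<tau> * (1 - \<tau>)) = sin (2 * \<theta>)"
      by (simp add: sin_double)
    then have "((\<lambda>\<tau>. arccos (sqrt \<tau>)) has_real_derivative - 1 / sin (2 * \<theta>)) (at \<tau>)"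
      using DERIV_arccos_sqrt[of \<tau>] \<tau> by simp
    then have g: "(g has_vector_derivative - 1 / sin (2 * \<theta>)) (at \<tau>)"
      unfolding has_real_derivative_iff_has_vector_derivative
      by (rule has_vector_derivative_transform_within_open[where S = "{0<..<1}"])
         (use \<tau> in \<open>simp_all add: g_def cos_squared_bij(2)\<close>)
    have "(F \<circ> g has_vector_derivative h \<theta>) (at \<tau>)"
      using vector_diff_chain_at[OF g, of F] F[OF \<theta>] by (simp add: h_def \<theta>_def)
    moreover have "(h \<circ> g has_vector_derivative (- 1 / sin (2 * \<theta>)) *\<^sub>R h' \<theta>) (at \<tau>)"
      using vector_diff_chain_at[OF g, of h] h[OF \<theta>] by (simp add: \<theta>_def)
    moreover have "of_real (\<tau> * (1 - \<tau>)) * ((- 1 / sin (2 * \<theta>)) *\<^sub>R h' \<theta>) + of_real (2 * (1 - n * \<tau>)) * h \<theta>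
      + of_real (k / 2 * (k / 2 + 2 * n - 1)) * F \<theta> = 0"
    proof -
      define c s where "c = cos \<theta>" and "s = sin \<theta>"
      have cs: "0 < c" "0 < s" "c\<^sup>2 + s\<^sup>2 = 1"
        using pos by (simp_all add: c_def s_def)
      have s2: "sin (2 * \<theta>) = 2 * s * c" and c2: "cos (2 * \<theta>) = 2 * c\<^sup>2 - 1"
        by (simp_all add: sin_double cos_double_cos c_def s_def)
      \<comment> \<open>This product is a quarter of the square of
        \<open>sin (2 * \<theta>)\<close>, which cancels the two factors \<open>g'\<close> in front
        of \<open>F''\<close>.\<close>
      have 1: "\<tau> * (1 - \<tau>) = s\<^sup>2 * c\<^sup>2"
        unfolding \<tau>_eq by (simp add: c_def s_def flip: sin_squared_eq)
      have "of_real (\<tau> * (1 - \<tau>)) * ((- 1 / sin (2 * \<theta>)) *\<^sub>R h' \<theta>) + of_real (2 * (1 - n * \<tau>)) * h \<theta>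
          = (1 / 4) *\<^sub>R F'' \<theta> + (- cos (2 * \<theta>) / (2 * sin (2 * \<theta>)) - 2 * (1 - n * \<tau>) / sin (2 * \<theta>)) *\<^sub>R F' \<theta>"
        using cs unfolding 1 h_def h'_def s2
        by (simp add: scaleR_conv_of_real field_simps power2_eq_square)
      also have "- cos (2 * \<theta>) / (2 * sin (2 * \<theta>)) - 2 * (1 - n * \<tau>) / sin (2 * \<theta>)
          = (6 * cot (2 * \<theta>) + (4 * n - 8) / tan \<theta>) / 4"
        using cs unfolding cot_def tan_def s2 c2 \<tau>_eq c_def[symmetric] s_def[symmetric]
        by (simp add: field_simps power2_eq_square)
      finally have "of_real (\<tau> * (1 - \<tau>)) * ((- 1 / sin (2 * \<theta>)) *\<^sub>R h' \<theta>) + of_real (2 * (1 - n * \<tau>)) * h \<theta>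
          + of_real (k / 2 * (k / 2 + 2 * n - 1)) * F \<theta>
          = (F'' \<theta> + of_real (6 * cot (2 * \<theta>) + (4 * n - 8) / tan \<theta>) * F' \<theta>
            + of_real (k * (k + 4 * n - 2)) * F \<theta>) / 4"
        by (simp only: scaleR_conv_of_real) (simp add: add_divide_distrib diff_divide_distrib algebra_simps)
      then show ?thesis
        by (simp only: ode[OF \<theta>]) simp
    qed
    ultimately show ?thesis
      by (simp add: \<theta>_def)
  qed
  then show ?thesis
    by (intro exI[of _ "h \<circ> g"] exI[of _ "\<lambda>\<tau>. (- 1 / sin (2 * g \<tau>)) *\<^sub>R h' (g \<tau>)"]) simp
qed

section \<open>The Laplacian of a bi-invariant polynomial\<close>

text \<open>The hypotheses make the ellipse a circle in a plane orthogonal to its centre vector, so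
  Pythagoras applies.\<close>

lemma norm_ellipse:
  fixes c p q :: "'a::real_inner"
  assumes "inner p q = 0" "inner q q = inner p p" "inner c p = 0" "inner c q = 0"
  shows "norm (ellipse c p q t) = norm (c + p)"
proof -
  have "inner (ellipse c p q t) (ellipse c p q t)
      = inner c c + cos t * cos t * inner p p + sin t * sin t * inner p p"
    using assms unfolding ellipse_def
    by (simp add: inner_add_left inner_add_right inner_commute)
  also have "\<dots> = inner c c + inner p p"
    by (simp add: add.assoc flip: distrib_right)
  finally show ?thesis
    using assms by (simp add: norm_eq inner_add_left inner_add_right inner_commute)
qed

text \<open>The circle conditions appear twice, for the whole vectors and for their first
  coordinates, because both norms must stay constant. A zero first coordinate of \<open>p\<close>
  and \<open>q\<close> is a degenerate circle and is allowed.\<close>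

lemma bi_invariant_ellipse:
  fixes f :: "quat ^ ('n :: {finite, linorder}) \<Rightarrow> complex"
  assumes "bi_invariant f"
    and "inner p q = 0" "inner q q = inner p p" "inner c p = 0" "inner c q = 0"
    and "inner (p $ Min UNIV) (q $ Min UNIV) = 0"
      "inner (q $ Min UNIV) (q $ Min UNIV) = inner (p $ Min UNIV) (p $ Min UNIV)"
      "inner (c $ Min UNIV) (p $ Min UNIV) = 0" "inner (c $ Min UNIV) (q $ Min UNIV) = 0"
  shows "f (ellipse c p q t) = f (c + p)"
proof (rule bi_invariant_eqI[OF assms(1)])
  have "ellipse c p q t $ Min UNIV = ellipse (c $ Min UNIV) (p $ Min UNIV) (q $ Min UNIV) t"
    by (simp add: ellipse_def)
  then show "norm (ellipse c p q t $ Min UNIV) = norm ((c + p) $ Min UNIV)"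
    using norm_ellipse[OF assms(6-9)] by simp
  show "norm (ellipse c p q t) = norm (c + p)"
    by (rule norm_ellipse[OF assms(2-5)])
qed

text \<open>Scaling both axes by \<open>r\<close> gives two factors \<open>r\<close> in the second
  derivative and one in the radial derivative; their quotient is \<open>1 / r\<close>.\<close>

lemma dird_dird_of_constant_along_circle:
  fixes f :: "'a::euclidean_space \<Rightarrow> 'b::euclidean_space"
  assumes f: "polynomial_function f" and "r \<noteq> 0"
    and "\<And>t. f (ellipse c (r *\<^sub>R u) (r *\<^sub>R b) t) = f (c + r *\<^sub>R u)"
  shows "dird b (dird b f) (c + r *\<^sub>R u) = (1 / r) *\<^sub>R dird u f (c + r *\<^sub>R u)"
proof -
  have scale: "dird (r *\<^sub>R v) g y = r *\<^sub>R dird v g y" if "polynomial_function g"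
    for v y and g :: "'a \<Rightarrow> 'b"
    using dird_linear_combination[OF that, of r v 0 0] by simp
  have "dird (r *\<^sub>R b) (dird (r *\<^sub>R b) f) y = r *\<^sub>R r *\<^sub>R dird b (dird b f) y" for y
    using dird_dird_linear_combination[OF f, of _ r b 0 0]
    by (simp add: scale polynomial_function_dird f)
  then have "r *\<^sub>R r *\<^sub>R dird b (dird b f) (c + r *\<^sub>R u) = r *\<^sub>R dird u f (c + r *\<^sub>R u)"
    using dird_dird_of_constant_along_ellipse[OF f assms(3)] by (simp add: scale f)
  then have "r *\<^sub>R dird b (dird b f) (c + r *\<^sub>R u) = dird u f (c + r *\<^sub>R u)"
    by (rule scaleR_left_imp_eq[OF \<open>r \<noteq> 0\<close>])
  then show ?thesis
    using \<open>r \<noteq> 0\<close> by (auto simp flip: \<open>r *\<^sub>R dird b (dird b f) (c + r *\<^sub>R u) = _\<close>)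
qed

lemma sum_Basis_vec:
  fixes f :: "'a::euclidean_space ^ 'n \<Rightarrow> 'b::comm_monoid_add"
  shows "sum f Basis = (\<Sum>i\<in>UNIV. \<Sum>e\<in>Basis. f (axis i e))"
proof -
  have "Basis = (\<Union>i. (\<lambda>e. axis i e :: 'a ^ 'n) ` Basis)"
    by (auto simp: Basis_vec_def)
  moreover have "sum f (\<Union>i. (\<lambda>e. axis i e :: 'a ^ 'n) ` Basis)
      = (\<Sum>i\<in>UNIV. sum f ((\<lambda>e. axis i e) ` Basis))"
    by (rule sum.UNION_disjoint) (auto simp: axis_eq_axis)
  moreover have "sum f ((\<lambda>e. axis i e) ` Basis) = (\<Sum>e\<in>Basis. f (axis i e))" for i
    by (subst sum.reindex) (auto simp: inj_on_def axis_eq_axis)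
  ultimately show ?thesis
    by simp
qed

lemma one_in_Basis_quat: "(1 :: quat) \<in> Basis"
  by (simp add: Basis_quat_def one_quat_def)

lemma card_Basis_quat: "card (Basis :: quat set) = 4"
  by (simp add: Basis_quat_def)

lemma Min_neq_Max_UNIV:
  assumes "CARD('n :: {finite, linorder}) \<ge> 2"
  shows "Min UNIV \<noteq> (Max UNIV :: 'n)"
proof
  assume eq: "Min UNIV = (Max UNIV :: 'n)"
  have "i = Max UNIV" for i :: 'n
  proof (rule antisym)
    show "i \<le> Max UNIV"
      by (rule Max_ge) simp_all
    show "Max UNIV \<le> i"
      unfolding eq[symmetric] by (rule Min_le) simp_all
  qed
  then have "(UNIV :: 'n set) = {Max UNIV}"
    by auto
  then have "CARD('n) = 1"
    by (metis card_1_singleton_iff One_nat_def)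
  with assms show False
    by simp
qed

text \<open>Besides \<open>u\<close> and \<open>v\<close>, three basis directions belong to the
  first coordinate, giving circles of radius \<open>s\<close>. The other
  \<open>3 + 4 (CARD('n) - 2) = 4 CARD('n) - 5\<close> directions give circles of radius
  \<open>t\<close>.\<close>

lemma laplacian_bi_invariant:
  fixes f :: "quat ^ ('n :: {finite, linorder}) \<Rightarrow> complex"
  assumes f: "polynomial_function f" "bi_invariant f"
    and card: "CARD('n) \<ge> 2" and st: "s \<noteq> 0" "t \<noteq> 0"
  defines "u \<equiv> axis (Min UNIV) 1 :: (quat, 'n) vec" and "v \<equiv> axis (Max UNIV) 1 :: (quat, 'n) vec"
  defines "x \<equiv> s *\<^sub>R u + t *\<^sub>R v"
  shows "laplacian f x = dird u (dird u f) x + dird v (dird v f) x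
    + (3 / s) *\<^sub>R dird u f x + ((4 * real CARD('n) - 5) / t) *\<^sub>R dird v f x"
proof -
  define o1 om where "o1 = Min (UNIV :: 'n set)" and "om = Max (UNIV :: 'n set)"
  have "o1 \<noteq> om"
    using Min_neq_Max_UNIV[OF card] by (simp add: o1_def om_def)
  define g where "g b = dird b (dird b f) x" for b
  have inner_one: "inner 1 e = (if e = 1 then 1 else 0)" "inner e e = 1" if "e \<in> Basis" for e :: quat
    using that one_in_Basis_quat by (auto simp: inner_Basis)
  have axis_component: "(axis i e :: (quat, 'n) vec) $ j = (if j = i then e else 0)" for i j e
    by (simp add: axis_def)
  have g1: "g (axis o1 e) = (1 / s) *\<^sub>R dird u f x" if "e \<in> Basis - {1}" for e
  \<comment> \<open>Rotates \<open>s *\<^sub>R u\<close> towards \<open>axis o1 e\<close> about the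
    centre \<open>t *\<^sub>R v\<close>; the sum is reordered to put the centre first.\<close>
  proof -
    have "dird (axis o1 e) (dird (axis o1 e) f) (t *\<^sub>R v + s *\<^sub>R u) = (1 / s) *\<^sub>R dird u f (t *\<^sub>R v + s *\<^sub>R u)"
      using that \<open>o1 \<noteq> om\<close> inner_one[of e] inner_one[OF one_in_Basis_quat]
      by (intro dird_dird_of_constant_along_circle f st bi_invariant_ellipse)
         (auto simp: u_def v_def inner_axis_axis axis_component simp flip: o1_def om_def)
    then show ?thesis
      by (simp add: g_def x_def add.commute)
  qed
  \<comment> \<open>Rotates \<open>t *\<^sub>R v\<close> about the centre
    \<open>s *\<^sub>R u\<close>. Intermediate coordinates admit all four \<open>e\<close>, the last
    one only the three other than 1.\<close>
  have g2: "g (axis i e) = (1 / t) *\<^sub>R dird v f x" if "e \<in> Basis" "i \<noteq> o1" "i = om \<Longrightarrow> e \<noteq> 1" for i e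
    unfolding g_def x_def
    using that \<open>o1 \<noteq> om\<close> inner_one[of e] inner_one[OF one_in_Basis_quat]
    by (intro dird_dird_of_constant_along_circle f st bi_invariant_ellipse)
       (auto simp: u_def v_def inner_axis_axis axis_component simp flip: o1_def om_def)
  have split: "(\<Sum>e\<in>Basis. h e) = h 1 + 3 *\<^sub>R z" if "\<And>e. e \<in> Basis - {1} \<Longrightarrow> h e = z"
    for h :: "quat \<Rightarrow> complex" and z
  proof -
    have "(\<Sum>e\<in>Basis. h e) = h 1 + (\<Sum>e\<in>Basis - {1}. h e)"
      by (simp add: sum.remove one_in_Basis_quat)
    also have "(\<Sum>e\<in>Basis - {1}. h e) = (\<Sum>e\<in>Basis - {1::quat}. z)"
      using that by (rule sum.cong[OF refl])
    finally show ?thesis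
      by (simp add: one_in_Basis_quat card_Basis_quat card_Diff_singleton scaleR_conv_of_real)
  qed
  have s1: "(\<Sum>e\<in>Basis. g (axis o1 e)) = g u + (3 / s) *\<^sub>R dird u f x"
    using split[of "\<lambda>e. g (axis o1 e)", OF g1] by (simp add: u_def o1_def)
  have s2: "(\<Sum>e\<in>Basis. g (axis om e)) = g v + (3 / t) *\<^sub>R dird v f x"
    using split[of "\<lambda>e. g (axis om e)", OF g2] \<open>o1 \<noteq> om\<close> by (simp add: v_def om_def)
  have s3: "(\<Sum>e\<in>Basis. g (axis i e)) = (4 / t) *\<^sub>R dird v f x" if "i \<in> UNIV - {o1} - {om}" for i
  proof -
    have "(\<Sum>e\<in>Basis. g (axis i e)) = (\<Sum>e\<in>(Basis :: quat set). (1 / t) *\<^sub>R dird v f x)"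
      using that by (intro sum.cong refl g2) auto
    then show ?thesis
      by (simp add: card_Basis_quat scaleR_conv_of_real)
  qed
  have "laplacian f x = (\<Sum>i\<in>UNIV. \<Sum>e\<in>Basis. g (axis i e))"
    by (simp add: laplacian_dird sum_Basis_vec g_def)
  also have "\<dots> = (\<Sum>e\<in>Basis. g (axis o1 e)) + ((\<Sum>e\<in>Basis. g (axis om e))
      + (\<Sum>i\<in>UNIV - {o1} - {om}. \<Sum>e\<in>Basis. g (axis i e)))"
    using \<open>o1 \<noteq> om\<close> by (subst sum.remove[of _ o1], simp, simp, subst sum.remove[of _ om]) auto
  also have "(\<Sum>i\<in>UNIV - {o1} - {om}. \<Sum>e\<in>Basis. g (axis i e))
      = (\<Sum>i\<in>UNIV - {o1} - {om}. (4 / t) *\<^sub>R dird v f x)"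
    by (rule sum.cong[OF refl s3])
  also have "\<dots> = (real CARD('n) - 2) *\<^sub>R (4 / t) *\<^sub>R dird v f x"
    using \<open>o1 \<noteq> om\<close> card by (simp add: card_Diff_singleton of_nat_diff scaleR_conv_of_real)
  finally show ?thesis
    unfolding s1 s2
    by (simp add: g_def scaleR_conv_of_real add_divide_distrib diff_divide_distrib algebra_simps)
qed

text \<open>The Laplacian of the plane of the curve is the sum of the radial and the tangential
  second derivative. Euler's identities evaluate the radial one, and the tangential one together
  with first-order terms is the second derivative of \<open>F\<close>.\<close>

lemma bi_invariant_harmonic_ode:
  fixes P :: "quat ^ ('n :: {finite, linorder}) \<Rightarrow> complex"
  assumes P: "P \<in> harmonic_polys k" "bi_invariant P" and card: "CARD('n) \<ge> 2"
    and \<theta>: "\<theta> \<in> {0<..<pi / 2}"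
  defines "u \<equiv> axis (Min UNIV) 1 :: (quat, 'n) vec" and "v \<equiv> axis (Max UNIV) 1 :: (quat, 'n) vec"
  defines "y \<equiv> ellipse 0 u v \<theta>"
  shows "(sin \<theta>)\<^sup>2 *\<^sub>R dird u (dird u P) y
      - (sin \<theta> * cos \<theta>) *\<^sub>R (dird v (dird u P) y + dird u (dird v P) y)
      + (cos \<theta>)\<^sup>2 *\<^sub>R dird v (dird v P) y - cos \<theta> *\<^sub>R dird u P y - sin \<theta> *\<^sub>R dird v P y
      + of_real (6 * cot (2 * \<theta>) + (4 * real CARD('n) - 8) / tan \<theta>)
        * ((- sin \<theta>) *\<^sub>R dird u P y + cos \<theta> *\<^sub>R dird v P y)
      + of_real (real k * (real k + 4 * real CARD('n) - 2)) * P y = 0"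
proof -
  define n where "n = real CARD('n)"
  define c s where "c = cos \<theta>" and "s = sin \<theta>"
  define w where "w = 6 * cot (2 * \<theta>) + (4 * n - 8) / tan \<theta>"
  have cs: "0 < c" "0 < s" "s\<^sup>2 = 1 - c\<^sup>2"
    using \<theta> by (auto simp: c_def s_def sin_squared_eq intro: cos_gt_zero sin_gt_zero)
  have pol: "polynomial_function P" and hom: "P (r *\<^sub>R x) = r ^ k *\<^sub>R P x"
    and harm: "laplacian P x = 0" for r x
    using P(1) by (simp_all add: harmonic_polys_def scaleR_conv_of_real)
  have y: "y = c *\<^sub>R u + s *\<^sub>R v"
    by (simp add: y_def ellipse_def c_def s_def)
  define S T where "S = dird u P y" and "T = dird v P y"
  define A B where "A = dird u (dird u P) y" and "B = dird v (dird v P) y"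
  define M where "M = dird v (dird u P) y + dird u (dird v P) y"
  have L: "A + B + (3 / c) *\<^sub>R S + ((4 * n - 5) / s) *\<^sub>R T = 0"
    using laplacian_bi_invariant[OF pol P(2) card, of c s] cs(1,2) harm
    by (simp add: A_def B_def S_def T_def n_def y u_def v_def)
  have E1: "c *\<^sub>R S + s *\<^sub>R T = real k *\<^sub>R P y"
    using euler_homogeneous[OF pol hom, of y] dird_linear_combination[OF pol, of c u s v]
    by (simp add: S_def T_def flip: y)
  have "dird y (dird y P) y = c *\<^sub>R dird y (dird u P) y + s *\<^sub>R dird y (dird v P) y"
    using dird_dird_linear_combination[OF pol, of y c u s v] by (simp flip: y)
  also have "\<dots> = c\<^sup>2 *\<^sub>R A + (s * c) *\<^sub>R M + s\<^sup>2 *\<^sub>R B"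
    using dird_linear_combination[OF polynomial_function_dird[OF pol], of c u s v]
    by (simp add: A_def B_def M_def power2_eq_square algebra_simps flip: y)
  finally have E2: "c\<^sup>2 *\<^sub>R A + (s * c) *\<^sub>R M + s\<^sup>2 *\<^sub>R B = (real k * (real k - 1)) *\<^sub>R P y"
    using euler_homogeneous2[OF pol hom, of y] by simp
  have "cot (2 * \<theta>) = (c\<^sup>2 - s\<^sup>2) / (2 * s * c)" "(4 * n - 8) / tan \<theta> = (4 * n - 8) * (c / s)"
    by (simp_all add: cot_def tan_def sin_double cos_double c_def s_def)
  then have w: "w = 6 * ((c\<^sup>2 - s\<^sup>2) / (2 * s * c)) + (4 * n - 8) * (c / s)"
    unfolding w_def by (simp only:)
  have "w * (- s) = 3 * (s\<^sup>2 / c) - (4 * n - 5) * c" "w * c = (4 * n - 5) * (c\<^sup>2 / s) - 3 * s"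
    unfolding w using cs(1,2) by (simp_all add: field_simps power2_eq_square)
  moreover have "s\<^sup>2 / c = 1 / c - c"
    unfolding cs(3) using cs(1) by (simp add: diff_divide_distrib power2_eq_square)
  moreover have "c\<^sup>2 = 1 - s\<^sup>2"
    using cs(3) by simp
  then have "c\<^sup>2 / s = 1 / s - s"
    using cs(2) by (simp add: diff_divide_distrib power2_eq_square)
  \<comment> \<open>So \<open>w\<close> times the first derivative of \<open>F\<close> is the
    first-order part of the Laplacian minus \<open>4 * n - 2\<close> times the radial term
    \<open>c *\<^sub>R S + s *\<^sub>R T\<close>. The terms
    \<open>- c *\<^sub>R S - s *\<^sub>R T\<close> of the second derivative raise that factor to
    \<open>4 * n - 1\<close>.\<close>
  ultimately have w1: "w * (- s) = 3 / c - (4 * n - 2) * c"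
      and w2: "w * c = (4 * n - 5) / s - (4 * n - 2) * s"
    by (simp_all add: diff_divide_distrib algebra_simps)
  have "s\<^sup>2 *\<^sub>R A - (s * c) *\<^sub>R M + c\<^sup>2 *\<^sub>R B - c *\<^sub>R S - s *\<^sub>R T
      + w *\<^sub>R ((- s) *\<^sub>R S + c *\<^sub>R T) + (real k * (real k + 4 * n - 2)) *\<^sub>R P y
    = (A + B + (3 / c) *\<^sub>R S + ((4 * n - 5) / s) *\<^sub>R T)
      - (c\<^sup>2 *\<^sub>R A + (s * c) *\<^sub>R M + s\<^sup>2 *\<^sub>R B)
      - (4 * n - 1) *\<^sub>R (c *\<^sub>R S + s *\<^sub>R T) + (real k * (real k + 4 * n - 2)) *\<^sub>R P y"
    unfolding scaleR_add_right[of w] scaleR_scaleR w1 w2 cs(3)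
    by (simp add: scaleR_conv_of_real algebra_simps)
  \<comment> \<open>The remaining coefficients of \<open>P y\<close> cancel:
    \<open>k (k - 1) + (4 n - 1) k = k (k + 4 n - 2)\<close>.\<close>
  also have "\<dots> = 0"
    unfolding L E1 E2 by (simp add: scaleR_conv_of_real algebra_simps)
  finally show ?thesis
    by (simp add: A_def B_def M_def S_def T_def w_def n_def c_def s_def scaleR_conv_of_real)
qed

section \<open>The curve on the sphere and the two differential equations\<close>

lemma curve_eq_ellipse:
  assumes "CARD('n) \<ge> 2"
  shows "(curve \<theta> :: quat ^ ('n :: {finite, linorder}))
    = ellipse 0 (axis (Min UNIV) 1) (axis (Max UNIV) 1) \<theta>"
  using Min_neq_Max_UNIV[OF assms]
  by (auto simp: vec_eq_iff curve_def ellipse_def axis_def quat_eq_iff of_real_def)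

lemma norm_curve:
  assumes "CARD('n) \<ge> 2"
  shows "norm (curve \<theta> :: quat ^ ('n :: {finite, linorder})) = 1"
  using Min_neq_Max_UNIV[OF assms]
  unfolding curve_eq_ellipse[OF assms]
  by (subst norm_ellipse) (simp_all add: inner_axis_axis inner_one_quat norm_eq_1)

theorem theorem3p1:
  fixes n k :: nat
    and P fP :: "quat ^ ('n :: {finite, linorder}) \<Rightarrow> complex"
    and F \<phi> :: "real \<Rightarrow> complex"
    and \<psi> :: "real \<Rightarrow> real"
  assumes n: "n = CARD('n)" "n \<ge> 2"
    and k: "even k"
    and P: "P \<in> harmonic_polys k" "bi_invariant P" "P \<noteq> (\<lambda>_. 0)"
    and fP: "fP = restrict P (sphere 0 1)"
    and F: "F = restrict (\<lambda>\<theta>. fP (curve \<theta>)) {0..pi / 2}"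
    and \<psi>: "\<psi> = (\<lambda>\<theta>. (cos \<theta>)\<^sup>2)"
    and \<phi>: "\<phi> = F \<circ> inv_into {0<..<pi / 2} \<psi>"
  shows "(\<exists>F' F''. \<forall>\<theta>\<in>{0<..<pi / 2}.
            (F has_vector_derivative F' \<theta>) (at \<theta>) \<and>
            (F' has_vector_derivative F'' \<theta>) (at \<theta>) \<and>
            F'' \<theta> + of_real (6 * cot (2 * \<theta>) + (4 * real n - 8) / tan \<theta>) * F' \<theta>
              + of_real (real k * (real k + 4 * real n - 2)) * F \<theta> = 0) \<and>
         smooth_diffeomorphism {0<..<pi / 2} {0<..<1} \<psi> \<and>
         (\<exists>\<phi>' \<phi>''. \<forall>\<tau>\<in>{0<..<1}.
            (\<phi> has_vector_derivative \<phi>' \<tau>) (at \<tau>) \<and>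
            (\<phi>' has_vector_derivative \<phi>'' \<tau>) (at \<tau>) \<and>
            of_real (\<tau> * (1 - \<tau>)) * \<phi>'' \<tau> + of_real (2 * (1 - real n * \<tau>)) * \<phi>' \<tau>
              + of_real (real k / 2 * (real k / 2 + 2 * real n - 1)) * \<phi> \<tau> = 0)"
proof -
  have card: "CARD('n) \<ge> 2"
    using n by simp
  have pol: "polynomial_function P"
    using P(1) by (simp add: harmonic_polys_def)
  define u v :: "(quat, 'n) vec" where "u = axis (Min UNIV) 1" and "v = axis (Max UNIV) 1"
  define y where "y = ellipse 0 u v"
  define F' where "F' \<theta> = (- sin \<theta>) *\<^sub>R dird u P (y \<theta>) + cos \<theta> *\<^sub>R dird v P (y \<theta>)" for \<theta>
  define F'' where "F'' \<theta> = (sin \<theta>)\<^sup>2 *\<^sub>R dird u (dird u P) (y \<theta>)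
      - (sin \<theta> * cos \<theta>) *\<^sub>R (dird v (dird u P) (y \<theta>) + dird u (dird v P) (y \<theta>))
      + (cos \<theta>)\<^sup>2 *\<^sub>R dird v (dird v P) (y \<theta>)
      - cos \<theta> *\<^sub>R dird u P (y \<theta>) - sin \<theta> *\<^sub>R dird v P (y \<theta>)" for \<theta>
  \<comment> \<open>The curve lies on the unit sphere, so both restrictions disappear here.\<close>
  have F_eq: "F \<theta> = P (y \<theta>)" if "\<theta> \<in> {0<..<pi / 2}" for \<theta>
    using that norm_curve[OF card, of \<theta>]
    by (simp add: F fP y_def u_def v_def curve_eq_ellipse[OF card])
  have F1: "(F has_vector_derivative F' \<theta>) (at \<theta>)" if "\<theta> \<in> {0<..<pi / 2}" for \<theta>
  \<comment> \<open>\<open>F\<close> is \<open>undefined\<close> outside the closed interval, so the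
    derivative is transferred from the polynomial on the open interval.\<close>
  proof (rule has_vector_derivative_transform_within_open[where S = "{0<..<pi / 2}"])
    show "((\<lambda>\<theta>. P (y \<theta>)) has_vector_derivative F' \<theta>) (at \<theta>)"
      unfolding F'_def y_def by (rule has_vector_derivative_along_ellipse[OF pol])
  qed (use that F_eq in auto)
  have F2: "(F' has_vector_derivative F'' \<theta>) (at \<theta>)" for \<theta>
    unfolding F'_def [abs_def] F''_def y_def by (rule has_vector_derivative2_along_ellipse[OF pol])
  have ode: "F'' \<theta> + of_real (6 * cot (2 * \<theta>) + (4 * real n - 8) / tan \<theta>) * F' \<theta>
      + of_real (real k * (real k + 4 * real n - 2)) * F \<theta> = 0" if "\<theta> \<in> {0<..<pi / 2}" for \<theta>
    using bi_invariant_harmonic_ode[OF P(1,2) card that]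
    unfolding F_eq[OF that] F'_def F''_def y_def u_def v_def n(1) .
  have "\<exists>F' F''. \<forall>\<theta>\<in>{0<..<pi / 2}.
      (F has_vector_derivative F' \<theta>) (at \<theta>) \<and>
      (F' has_vector_derivative F'' \<theta>) (at \<theta>) \<and>
      F'' \<theta> + of_real (6 * cot (2 * \<theta>) + (4 * real n - 8) / tan \<theta>) * F' \<theta>
        + of_real (real k * (real k + 4 * real n - 2)) * F \<theta> = 0"
    by (intro exI[of _ F'] exI[of _ F''] ballI conjI F1 F2 ode)
  then show ?thesis
    unfolding \<phi> \<psi>
    by (intro conjI[OF _ conjI[OF smooth_diffeomorphism_cos_squared
          hypergeometric_of_trigonometric[OF F1 F2 ode]]])
qed

end
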